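(* There is a non-adaptive query algorithm with the following guarantee. Let $G=(V,E)$ be a simple graph with $n$ vertices, $m$ edges and h-index $h$, accessible through $\texttt{Degree}$ and $\texttt{Random Edge}$ queries, and let $\varepsilon_\mathcal{D},\varepsilon_\mathcal{R}\in(0,1)$. Given $n$, $m$, $\varepsilon_\mathcal{D}$, $\varepsilon_\mathcal{R}$ and a value $h'\in[h/2,h]$, the algorithm makes $\tilde O\big(\frac{n}{h\varepsilon_\mathcal{R}^2}+\frac{m}{h\varepsilon_\mathcal{D}^2}\big)$ non-adaptive queries, and with high probability its output $\widehat{C}$ is an $(\varepsilon_\mathcal{D},\varepsilon_\mathcal{R})$-BiCriteria Multiplicative Approximation of the ccdh $C$ of $G$.
   Context: Queries: $\texttt{Degree}(v)$ returns the degree $\deg(v)$ of vertex $v$; $\texttt{Random Edge}$ returns an edge of $E$ chosen uniformly at random. Non-adaptive means all queries are fixed in advance from the input parameters (and internal randomness), not depending on earlier answers. The ccdh is $C(y)=|\{v\in V:\deg(v)\ge y\}|$, considered on $d\in\{1,\dots,n\}$. The h-index of $G$ is the largest $d\in[n]$ with $|\{v:\deg(v)\ge d\}|\ge d$. $\widehat{C}$ is an $(\varepsilon_\mathcal{D},\varepsilon_\mathcal{R})$-BiCriteria Multiplicative Approximation of $C$ if for every $d$, $(1-\varepsilon_\mathcal{R})C((1+\varepsilon_\mathcal{D})d)\le\widehat{C}(d)\le(1+\varepsilon_\mathcal{R})C((1-\varepsilon_\mathcal{D})d)$. $\tilde O(\cdot)$ hides polylogarithmic factors in $n$. "With high probability"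 means with probability at least $1-1/n^{c}$ for a sufficiently large universal constant $c$. *)

theory Defs
  imports "HOL-Probability.Probability"
begin

definition simple_graph :: "'v set \<Rightarrow> 'v set set \<Rightarrow> bool" where
  "simple_graph V E \<longleftrightarrow> finite V \<and> (\<forall>e\<in>E. e \<subseteq> V \<and> card e = 2)"

definition vdeg :: "'v set set \<Rightarrow> 'v \<Rightarrow> nat" where
  "vdeg E v = card {e \<in> E. v \<in> e}"

text \<open>The argument is real because the approximation guarantee evaluates the ccdh at
  the points \<open>(1 + \<epsilon>) d\<close> and \<open>(1 - \<epsilon>) d\<close>.\<close>

definition ccdh :: "'v set \<Rightarrow> 'v set set \<Rightarrow> real \<Rightarrow> nat" where
  "ccdh V E y = card {v \<in> V. y \<le> real (vdeg E v)}"

text \<open>The maximum ranges over positive integers, so a graph without edges has no h-index.\<close>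

definition is_h_index :: "'v set \<Rightarrow> 'v set set \<Rightarrow> nat \<Rightarrow> bool" where
  "is_h_index V E h \<longleftrightarrow>
     h \<in> {1..card V} \<and> h \<le> ccdh V E (real h) \<and>
     (\<forall>d \<in> {1..card V}. d \<le> ccdh V E (real d) \<longrightarrow> d \<le> h)"

definition bicriteria_approx ::
    "'v set \<Rightarrow> 'v set set \<Rightarrow> real \<Rightarrow> real \<Rightarrow> (nat \<Rightarrow> real) \<Rightarrow> bool" where
  "bicriteria_approx V E \<epsilon>D \<epsilon>R C' \<longleftrightarrow>
     (\<forall>d \<in> {1..card V}.
        (1 - \<epsilon>R) * real (ccdh V E ((1 + \<epsilon>D) * real d)) \<le> C' d \<and>
        C' d \<le> (1 + \<epsilon>R) * real (ccdh V E ((1 - \<epsilon>D) * real d)))"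

datatype 'v query = Degree 'v | Random_Edge

datatype 'v answer = Degree_Answer nat | Edge_Answer "'v set"

fun answer_query :: "'v set set \<Rightarrow> 'v query \<Rightarrow> 'v answer pmf" where
  "answer_query E (Degree v) = return_pmf (Degree_Answer (vdeg E v))"
| "answer_query E Random_Edge = map_pmf Edge_Answer (pmf_of_set E)"

fun answer_queries :: "'v set set \<Rightarrow> 'v query list \<Rightarrow> 'v answer list pmf" where
  "answer_queries E [] = return_pmf []"
| "answer_queries E (q # qs) =
     do { a \<leftarrow> answer_query E q; as \<leftarrow> answer_queries E qs; return_pmf (a # as) }"

text \<open>A plan is a non-adaptive algorithm with its internal randomness fixed: the complete
  list of queries, followed by the function that turns the list of answers into the output
  \<open>\<lambda>d. C' d\<close>. A randomized non-adaptive algorithm is a distribution over plans. The plan is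
  drawn before any answer is seen, and its two components may share randomness.\<close>

type_synonym 'v plan = "'v query list \<times> ('v answer list \<Rightarrow> nat \<Rightarrow> real)"

definition run_plans :: "'v set set \<Rightarrow> 'v plan pmf \<Rightarrow> (nat \<Rightarrow> real) pmf" where
  "run_plans E P =
     do { (qs, out) \<leftarrow> P; as \<leftarrow> answer_queries E qs; return_pmf (out as) }"

definition valid_queries :: "'v set \<Rightarrow> 'v query list \<Rightarrow> bool" where
  "valid_queries V qs \<longleftrightarrow> (\<forall>v. Degree v \<in> set qs \<longrightarrow> v \<in> V)"

end

theory Submission
  imports Defs
begin

text \<open>
  For \<open>d \<le> h'\<close> we have \<open>C d \<ge> h\<close>, so sampling \<open>O(n log n / (h \<epsilon>R\<^sup>2))\<close> uniform vertices and
  querying their degrees estimates \<open>C d\<close> up to a factor \<open>1 \<plusminus> \<epsilon>R\<close>. For \<open>d > h' \<ge> h / 2\<close> a vertex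
  of degree about \<open>d\<close> is hit by \<open>\<Omega>(log n / \<epsilon>D\<^sup>2)\<close> of \<open>O(m log n / (h \<epsilon>D\<^sup>2))\<close> random edges, so
  the sampled edges decide \<open>deg v \<ge> d\<close> up to a factor \<open>1 \<plusminus> \<epsilon>D\<close> in \<open>d\<close>; counting the vertices that
  pass this test estimates \<open>C d\<close> with no further error. Chernoff bounds and a union bound over
  all \<open>d\<close> and \<open>v\<close> give the failure probability.
\<close>

section \<open>Chernoff bounds for independent samples\<close>

lemma nn_integral_replicate_pmf_prod_list:
  fixes f :: "'a \<Rightarrow> ennreal"
  shows "(\<integral>\<^sup>+xs. prod_list (map f xs) \<partial>measure_pmf (replicate_pmf k p)) =
    (\<integral>\<^sup>+x. f x \<partial>measure_pmf p) ^ k"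
  by (induction k) (simp_all add: nn_integral_bind_pmf nn_integral_cmult nn_integral_multc)

text \<open>The exponential moment method for both tails at once: the sign of \<open>t\<close>
  decides whether \<open>Q\<close> may be the event that the count is at least \<open>a\<close> or
  at most \<open>a\<close>. The moment of one draw is bounded by \<open>1 + x \<le> exp x\<close>,
  and independence raises it to the power \<open>k\<close>.\<close>

lemma chernoff_replicate_pmf:
  fixes t a :: real
  assumes "\<And>xs. Q xs \<Longrightarrow> t * a \<le> t * real (length (filter P xs))"
  shows "measure_pmf.prob (replicate_pmf k p) {xs. Q xs} \<le>
    exp (real k * measure_pmf.prob p {x. P x} * (exp t - 1) - t * a)"
proof -
  let ?q = "measure_pmf.prob p {x. P x}"
  let ?f = "\<lambda>x. if P x then exp t else (1::real)"
  have f: "?f x = 1 + (exp t - 1) * indicator {x. P x} x" for x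
    by simp
  have ind: "integrable (measure_pmf p) (indicat_real {x. P x})"
    by (rule measure_pmf.integrable_const_bound[where B = 1]) (auto simp: indicator_def)
  have "measure_pmf.expectation p ?f = 1 + (exp t - 1) * ?q"
    unfolding f using ind by (subst Bochner_Integration.integral_add) auto
  also have "\<dots> \<le> exp (?q * (exp t - 1))"
    using exp_ge_add_one_self[of "?q * (exp t - 1)"] by (simp add: mult.commute)
  finally have le: "measure_pmf.expectation p ?f \<le> exp (?q * (exp t - 1))" .
  have "integrable (measure_pmf p) ?f"
    by (rule measure_pmf.integrable_const_bound[where B = "exp t + 1"]) auto
  then have "(\<integral>\<^sup>+x. ennreal (?f x) \<partial>measure_pmf p) = ennreal (measure_pmf.expectation p ?f)"
    by (intro nn_integral_eq_integral) auto
  also have "\<dots> \<le> ennreal (exp (?q * (exp t - 1)))"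
    using le by (rule ennreal_leI)
  finally have mgf: "(\<integral>\<^sup>+x. ennreal (?f x) \<partial>measure_pmf p) \<le> ennreal (exp (?q * (exp t - 1)))" .
  have prod: "ennreal (exp (t * real (length (filter P xs)))) = prod_list (map (\<lambda>x. ennreal (?f x)) xs)"
    for xs
    by (induction xs) (auto simp: distrib_left exp_add ennreal_mult)
  have "emeasure (measure_pmf (replicate_pmf k p)) {xs. Q xs} =
      (\<integral>\<^sup>+xs. indicator {xs. Q xs} xs \<partial>measure_pmf (replicate_pmf k p))"
    by simp
  \<comment> \<open>Markov's inequality inside the integral: on \<open>Q\<close> the exponential
    weight is at least 1.\<close>
  also have "\<dots> \<le> (\<integral>\<^sup>+xs. ennreal (exp (- t * a)) * ennreal (exp (t * real (length (filter P xs))))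
      \<partial>measure_pmf (replicate_pmf k p))"
  proof (rule nn_integral_mono)
    fix xs
    show "indicator {xs. Q xs} xs \<le>
        ennreal (exp (- t * a)) * ennreal (exp (t * real (length (filter P xs))))"
      using assms[of xs]
      by (auto simp: indicator_def exp_add[symmetric] simp flip: ennreal_mult ennreal_1)
  qed
  also have "\<dots> = ennreal (exp (- t * a)) * (\<integral>\<^sup>+x. ennreal (?f x) \<partial>measure_pmf p) ^ k"
    unfolding prod by (simp add: nn_integral_cmult nn_integral_replicate_pmf_prod_list)
  also have "\<dots> \<le> ennreal (exp (- t * a)) * ennreal (exp (?q * (exp t - 1))) ^ k"
    by (intro mult_left_mono power_mono mgf) auto
  also have "\<dots> = ennreal (exp (real k * ?q * (exp t - 1) - t * a))"
    by (simp add: ennreal_power exp_of_nat_mult[symmetric] ennreal_mult[symmetric]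
        exp_add[symmetric] algebra_simps)
  finally show ?thesis
    by (simp add: measure_pmf.emeasure_eq_measure)
qed

text \<open>A quadratic bound valid for both signs of \<open>t\<close>, so that the two tails get
  the same exponent.\<close>

lemma exp_minus_one_le:
  fixes t :: real
  assumes "\<bar>t\<bar> \<le> 1"
  shows "exp t - 1 \<le> t + t\<^sup>2"
proof (cases "0 \<le> t")
  case True
  then show ?thesis using exp_bound[of t] assms by simp
next
  case False
  have "exp t = 1 / exp (- t)" by (simp add: exp_minus field_simps)
  also have "\<dots> \<le> 1 / (1 - t)"
    using False exp_ge_add_one_self[of "- t"] by (intro divide_left_mono) auto
  also have "\<dots> \<le> 1 + t + t\<^sup>2"
  proof -
    \<comment> \<open>\<open>(1 - t) * (1 + t + t\<^sup>2) = 1 - t ^ 3\<close>, which is at least 1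
      for negative \<open>t\<close>.\<close>
    have "0 \<le> t\<^sup>2 * (- t)" using False by (intro mult_nonneg_nonneg) auto
    then show ?thesis
      using False by (simp add: field_simps power2_eq_square)
  qed
  finally show ?thesis by simp
qed

text \<open>\<open>M\<close> only bounds the mean from above, because the edge test compares a count
  with a threshold while the degree behind it is known only up to an inequality.\<close>

lemma chernoff_upper_tail:
  fixes \<epsilon> M :: real
  assumes "0 < \<epsilon>" "\<epsilon> \<le> 1" "real k * measure_pmf.prob p {x. P x} \<le> M"
  shows "measure_pmf.prob (replicate_pmf k p) {xs. (1 + \<epsilon>) * M \<le> real (length (filter P xs))}
    \<le> exp (- M * \<epsilon>\<^sup>2 / 4)"
proof -
  \<comment> \<open>The exponent is at most \<open>M * (t\<^sup>2 - t * \<epsilon>)\<close>, which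
    is smallest at this \<open>t\<close>.\<close>
  let ?t = "\<epsilon> / 2"
  have "0 \<le> real k * measure_pmf.prob p {x. P x}" by simp
  then have M: "0 \<le> M" using assms(3) by linarith
  have "measure_pmf.prob (replicate_pmf k p) {xs. (1 + \<epsilon>) * M \<le> real (length (filter P xs))}
      \<le> exp (real k * measure_pmf.prob p {x. P x} * (exp ?t - 1) - ?t * ((1 + \<epsilon>) * M))"
    by (rule chernoff_replicate_pmf) (use assms in auto)
  also have "\<dots> \<le> exp (M * (?t + ?t\<^sup>2) - ?t * ((1 + \<epsilon>) * M))"
  proof -
    have "real k * measure_pmf.prob p {x. P x} * (exp ?t - 1) \<le> M * (exp ?t - 1)"
      using assms by (intro mult_right_mono) auto
    also have "\<dots> \<le> M * (?t + ?t\<^sup>2)"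
      using assms M by (intro mult_left_mono exp_minus_one_le) auto
    finally show ?thesis by simp
  qed
  also have "M * (?t + ?t\<^sup>2) - ?t * ((1 + \<epsilon>) * M) = - M * \<epsilon>\<^sup>2 / 4"
    by (simp add: field_simps power2_eq_square)
  finally show ?thesis .
qed

text \<open>The mirror image with negative \<open>t\<close>: \<open>exp t - 1\<close> is then
  negative, so a lower bound on the mean bounds the exponent from above.\<close>

lemma chernoff_lower_tail:
  fixes \<epsilon> M :: real
  assumes "0 < \<epsilon>" "\<epsilon> \<le> 1" "0 \<le> M" "M \<le> real k * measure_pmf.prob p {x. P x}"
  shows "measure_pmf.prob (replicate_pmf k p) {xs. real (length (filter P xs)) \<le> (1 - \<epsilon>) * M}
    \<le> exp (- M * \<epsilon>\<^sup>2 / 4)"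
proof -
  let ?t = "- (\<epsilon> / 2)"
  have "measure_pmf.prob (replicate_pmf k p) {xs. real (length (filter P xs)) \<le> (1 - \<epsilon>) * M}
      \<le> exp (real k * measure_pmf.prob p {x. P x} * (exp ?t - 1) - ?t * ((1 - \<epsilon>) * M))"
    by (rule chernoff_replicate_pmf) (use assms in auto)
  also have "\<dots> \<le> exp (M * (?t + ?t\<^sup>2) - ?t * ((1 - \<epsilon>) * M))"
  proof -
    have "real k * measure_pmf.prob p {x. P x} * (exp ?t - 1) \<le> M * (exp ?t - 1)"
      using assms by (intro mult_right_mono_neg) auto
    also have "\<dots> \<le> M * (?t + ?t\<^sup>2)"
      using assms by (intro mult_left_mono exp_minus_one_le) auto
    finally show ?thesis by simp
  qed
  also have "M * (?t + ?t\<^sup>2) - ?t * ((1 - \<epsilon>) * M) = - M * \<epsilon>\<^sup>2 / 4"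
    by (simp add: field_simps power2_eq_square)
  finally show ?thesis .
qed

section \<open>The estimator, the sampling plan and the distribution of a run\<close>

lemma ccdh_antimono:
  assumes "finite V" "x \<le> y"
  shows "ccdh V E y \<le> ccdh V E x"
  unfolding ccdh_def using assms by (intro card_mono) auto

text \<open>This test and \<open>edge_at\<close> are false on answers of the other kind, so counting
  over the whole answer list separates the two samples without tracking positions.\<close>

fun degree_at_least :: "nat \<Rightarrow> 'v answer \<Rightarrow> bool" where
  "degree_at_least d (Degree_Answer k) = (d \<le> k)"
| "degree_at_least d (Edge_Answer e) = False"

fun edge_at :: "'v \<Rightarrow> 'v answer \<Rightarrow> bool" where
  "edge_at v (Degree_Answer k) = False"
| "edge_at v (Edge_Answer e) = (v \<in> e)"

text \<open>A random edge contains \<open>v\<close> with probability \<open>deg v / m\<close>, so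
  \<open>m / r\<close> times the number of hits is an unbiased estimate of \<open>deg v\<close>; the
  second branch thresholds it at \<open>d\<close>.\<close>

definition ccdh_estimate ::
    "'v set \<Rightarrow> nat \<Rightarrow> nat \<Rightarrow> nat \<Rightarrow> real \<Rightarrow> 'v answer list \<Rightarrow> nat \<Rightarrow> real" where
  "ccdh_estimate V m s r h' as d =
     (if real d \<le> h' then real (card V) / real s * real (length (filter (degree_at_least d) as))
      else real (card {v \<in> V. real d \<le> real m / real r * real (length (filter (edge_at v) as))}))"

text \<open>The internal randomness is the choice of vertices, with replacement; the randomness of
  the edges comes from the answers. The output function does not depend on which vertices were
  drawn.\<close>

definition sampling_plan :: "'v set \<Rightarrow> nat \<Rightarrow> nat \<Rightarrow> nat \<Rightarrow> real \<Rightarrow> 'v plan pmf" where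
  "sampling_plan V m s r h' =
     map_pmf (\<lambda>vs. (map Degree vs @ replicate r Random_Edge, ccdh_estimate V m s r h'))
       (replicate_pmf s (pmf_of_set V))"

lemma answer_queries_Degree_append:
  "answer_queries E (map Degree vs @ qs) =
     map_pmf ((@) (map (\<lambda>v. Degree_Answer (vdeg E v)) vs)) (answer_queries E qs)"
  by (induction vs) (simp_all add: bind_return_pmf map_pmf_def bind_assoc_pmf)

lemma answer_queries_Random_Edge:
  "answer_queries E (replicate r Random_Edge) =
     map_pmf (map Edge_Answer) (replicate_pmf r (pmf_of_set E))"
  by (induction r) (simp_all add: bind_return_pmf map_pmf_def bind_assoc_pmf)

text \<open>Degree answers are determined by the drawn vertices, so a run is a function of two
  independent samples, and failures can be bounded on each of them separately.\<close>

lemma run_sampling_plan: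
  "run_plans E (sampling_plan V m s r h') =
     map_pmf (\<lambda>(vs, es). ccdh_estimate V m s r h'
         (map (\<lambda>v. Degree_Answer (vdeg E v)) vs @ map Edge_Answer es))
       (pair_pmf (replicate_pmf s (pmf_of_set V)) (replicate_pmf r (pmf_of_set E)))"
  unfolding run_plans_def sampling_plan_def
  by (simp add: answer_queries_Degree_append answer_queries_Random_Edge pair_pmf_def
      map_pmf_def bind_return_pmf bind_assoc_pmf)

lemma sampling_plan_queries:
  assumes "finite V" "V \<noteq> {}" "(qs, out) \<in> set_pmf (sampling_plan V m s r h')"
  shows "valid_queries V qs" "length qs = s + r"
  using assms by (auto simp: sampling_plan_def valid_queries_def set_replicate_pmf lists_def)

lemma degree_count:
  "length (filter (degree_at_least d)
     (map (\<lambda>v. Degree_Answer (vdeg E v)) vs @ map Edge_Answer es)) =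
   length (filter (\<lambda>v. d \<le> vdeg E v) vs)"
  by (simp add: filter_map o_def)

lemma edge_count:
  "length (filter (edge_at v)
     (map (\<lambda>v. Degree_Answer (vdeg E v)) vs @ map Edge_Answer es)) =
   length (filter (\<lambda>e. v \<in> e) es)"
  by (simp add: filter_map o_def)

section \<open>Failure probability of a single estimate\<close>

lemma prob_degree_at_least:
  assumes "finite V" "V \<noteq> {}"
  shows "measure_pmf.prob (pmf_of_set V) {v. d \<le> vdeg E v} = real (ccdh V E (real d)) / real (card V)"
  using assms by (simp add: measure_pmf_of_set ccdh_def Int_def)

lemma prob_edge_at:
  assumes "finite E" "E \<noteq> {}"
  shows "measure_pmf.prob (pmf_of_set E) {e. v \<in> e} = real (vdeg E v) / real (card E)"
  using assms by (simp add: measure_pmf_of_set vdeg_def Int_def)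

text \<open>The count has mean \<open>M = s * C(d) / card V\<close>. A failure is a relative
  deviation by \<epsilon> to one side or the other, each bounded by a Chernoff tail, whence the
  factor 2.\<close>

lemma degree_sampling_failure:
  fixes \<epsilon> L :: real
  assumes "finite V" "V \<noteq> {}" "0 < s" "0 < \<epsilon>" "\<epsilon> \<le> 1"
    and L: "L \<le> real s * real (ccdh V E (real d)) / real (card V) * \<epsilon>\<^sup>2"
  shows "measure_pmf.prob (replicate_pmf s (pmf_of_set V))
      {vs. \<not> ((1 - \<epsilon>) * real (ccdh V E (real d)) \<le>
             real (card V) / real s * real (length (filter (\<lambda>v. d \<le> vdeg E v) vs)) \<and>
           real (card V) / real s * real (length (filter (\<lambda>v. d \<le> vdeg E v) vs)) \<le>
             (1 + \<epsilon>) * real (ccdh V E (real d)))}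
    \<le> 2 * exp (- L / 4)" (is "measure_pmf.prob ?S ?B \<le> _")
proof -
  let ?P = "\<lambda>v. d \<le> vdeg E v"
  let ?X = "\<lambda>vs. real (length (filter ?P vs))"
  define M where "M = real s * real (ccdh V E (real d)) / real (card V)"
  have V: "0 < card V" using assms by (simp add: card_gt_0_iff)
  have q: "real s * measure_pmf.prob (pmf_of_set V) {v. ?P v} = M"
    using assms by (simp add: prob_degree_at_least M_def)
  have M: "0 \<le> M" by (simp add: M_def)
  have C: "real (ccdh V E (real d)) = real (card V) / real s * M"
    using V assms by (simp add: M_def)
  have pos: "0 < real (card V) / real s" using V assms by simp
  have "vs \<in> {vs. (1 + \<epsilon>) * M \<le> ?X vs} \<union> {vs. ?X vs \<le> (1 - \<epsilon>) * M}" if "vs \<in> ?B" for vs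
  proof (rule ccontr)
    assume "\<not> ?thesis"
    then have "(1 - \<epsilon>) * M \<le> ?X vs" "?X vs \<le> (1 + \<epsilon>) * M" by auto
    \<comment> \<open>Scaling by \<open>card V / s\<close> turns bounds on the count around
      \<open>M\<close> into bounds on the estimate around \<open>C(d)\<close>.\<close>
    from this[THEN mult_left_mono[OF _ less_imp_le[OF pos]]] show False
      using that unfolding C by (simp add: mult.left_commute)
  qed
  then have "measure_pmf.prob ?S ?B \<le>
      measure_pmf.prob ?S ({vs. (1 + \<epsilon>) * M \<le> ?X vs} \<union> {vs. ?X vs \<le> (1 - \<epsilon>) * M})"
    by (intro measure_pmf.finite_measure_mono) auto
  also have "\<dots> \<le> measure_pmf.prob ?S {vs. (1 + \<epsilon>) * M \<le> ?X vs} +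
      measure_pmf.prob ?S {vs. ?X vs \<le> (1 - \<epsilon>) * M}"
    by (intro measure_Un_le) auto
  also have "\<dots> \<le> exp (- M * \<epsilon>\<^sup>2 / 4) + exp (- M * \<epsilon>\<^sup>2 / 4)"
    using assms M q by (intro add_mono chernoff_upper_tail chernoff_lower_tail) auto
  also have "\<dots> \<le> 2 * exp (- L / 4)"
    using L by (simp add: M_def)
  finally show ?thesis .
qed

text \<open>The test must be right only for degrees outside the gap between
  \<open>(1 - \<epsilon>) * y\<close> and \<open>(1 + \<epsilon>) * y\<close>. Above the gap failure
  is a lower tail, below it an upper tail, and inside it any outcome is acceptable.\<close>

lemma edge_sampling_failure:
  fixes \<epsilon> L y :: real
  assumes "finite E" "E \<noteq> {}" "0 < r" "0 < \<epsilon>" "\<epsilon> \<le> 1" "0 \<le> y"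
    and L: "L \<le> real r * y / real (card E) * \<epsilon>\<^sup>2"
  shows "measure_pmf.prob (replicate_pmf r (pmf_of_set E))
      {es. \<not> (((1 + \<epsilon>) * y \<le> real (vdeg E v) \<longrightarrow>
              y \<le> real (card E) / real r * real (length (filter (\<lambda>e. v \<in> e) es))) \<and>
            (y \<le> real (card E) / real r * real (length (filter (\<lambda>e. v \<in> e) es)) \<longrightarrow>
              (1 - \<epsilon>) * y \<le> real (vdeg E v)))}
    \<le> exp (- L / 16)" (is "measure_pmf.prob ?S ?B \<le> _")
proof -
  let ?X = "\<lambda>es. real (length (filter (\<lambda>e. v \<in> e) es))"
  \<comment> \<open>The threshold \<open>y\<close> on the scale of counts; \<open>q\<close> below is
    the expected count.\<close>
  define a where "a = real r * y / real (card E)"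
  have E: "0 < card E" using assms by (simp add: card_gt_0_iff)
  have a: "0 \<le> a" using assms by (simp add: a_def)
  have iff: "y \<le> real (card E) / real r * x \<longleftrightarrow> a \<le> x" for x
    using E assms by (simp add: a_def field_simps)
  define q where "q = real r * measure_pmf.prob (pmf_of_set E) {e. v \<in> e}"
  have q: "q = real r / real (card E) * real (vdeg E v)"
    using assms by (simp add: prob_edge_at q_def)
  have pos: "0 < real r / real (card E)" using E assms by simp
  have L': "L \<le> a * \<epsilon>\<^sup>2" using L by (simp add: a_def)
  consider (high) "(1 + \<epsilon>) * y \<le> real (vdeg E v)" | (low) "real (vdeg E v) < (1 - \<epsilon>) * y"
    | (mid) "real (vdeg E v) < (1 + \<epsilon>) * y" "(1 - \<epsilon>) * y \<le> real (vdeg E v)"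
    by linarith
  then show ?thesis
  proof cases
    case high
    have "(1 - \<epsilon>) * y \<le> (1 + \<epsilon>) * y" using assms by (intro mult_right_mono) auto
    then have "(1 - \<epsilon>) * y \<le> real (vdeg E v)" using high by linarith
    have "(1 + \<epsilon>) * a \<le> q"
      using mult_left_mono[OF high less_imp_le[OF pos]] by (simp add: q a_def mult_ac)
    \<comment> \<open>Half of \<epsilon> suffices as deviation:
      \<open>(1 - \<epsilon> / 2) * (1 + \<epsilon>) \<ge> 1\<close>, so a count below
      \<open>a\<close> lies in this tail. Halving \<epsilon> turns the 4 of the Chernoff exponent
      into 16.\<close>
    then have "measure_pmf.prob ?S {es. ?X es \<le> (1 - \<epsilon> / 2) * ((1 + \<epsilon>) * a)}
        \<le> exp (- ((1 + \<epsilon>) * a) * (\<epsilon> / 2)\<^sup>2 / 4)"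
      using assms a by (intro chernoff_lower_tail) (auto simp: q_def)
    moreover have "?B \<subseteq> {es. ?X es \<le> (1 - \<epsilon> / 2) * ((1 + \<epsilon>) * a)}"
    proof -
      have "\<epsilon> * \<epsilon> \<le> \<epsilon> * 1" using assms by (intro mult_left_mono) auto
      then have "1 \<le> (1 - \<epsilon> / 2) * (1 + \<epsilon>)" by (simp add: algebra_simps)
      from mult_right_mono[OF this a] have "a \<le> (1 - \<epsilon> / 2) * ((1 + \<epsilon>) * a)"
        by (simp only: mult_1_left mult.assoc)
      then have "x \<le> (1 - \<epsilon> / 2) * ((1 + \<epsilon>) * a)" if "\<not> a \<le> x" for x
        using that by linarith
      then show ?thesis
        using \<open>(1 - \<epsilon>) * y \<le> real (vdeg E v)\<close> unfolding iff by blast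
    qed
    then have "measure_pmf.prob ?S ?B \<le>
        measure_pmf.prob ?S {es. ?X es \<le> (1 - \<epsilon> / 2) * ((1 + \<epsilon>) * a)}"
      by (intro measure_pmf.finite_measure_mono) auto
    moreover have "L / 16 \<le> ((1 + \<epsilon>) * a) * (\<epsilon> / 2)\<^sup>2 / 4"
    proof -
      have "0 \<le> \<epsilon> * (a * \<epsilon>\<^sup>2)" using assms a by simp
      then show ?thesis using L' by (simp add: power_divide algebra_simps)
    qed
    then have "exp (- ((1 + \<epsilon>) * a) * (\<epsilon> / 2)\<^sup>2 / 4) \<le> exp (- L / 16)" by simp
    ultimately show ?thesis by linarith
  next
    case low
    \<comment> \<open>Chosen so that the upper tail starts exactly at the threshold
      \<open>a\<close>. It bounds the mean because \<open>q \<le> (1 - \<epsilon>) * a\<close> and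
      \<open>(1 - \<epsilon>) * (1 + \<epsilon>) \<le> 1\<close>.\<close>
    define M where "M = a / (1 + \<epsilon>)"
    have aM: "(1 + \<epsilon>) * M = a" using assms by (simp add: M_def)
    have "(1 - \<epsilon>) * (1 + \<epsilon>) \<le> 1" by (simp add: algebra_simps)
    from mult_right_mono[OF this a] have "(1 - \<epsilon>) * a \<le> M"
      using assms by (simp add: M_def pos_le_divide_eq mult_ac)
    moreover have "q \<le> (1 - \<epsilon>) * a"
      using mult_left_mono[OF less_imp_le[OF low] less_imp_le[OF pos]]
      by (simp add: q a_def mult_ac)
    ultimately have "measure_pmf.prob ?S {es. (1 + \<epsilon>) * M \<le> ?X es} \<le> exp (- M * \<epsilon>\<^sup>2 / 4)"
      using assms by (intro chernoff_upper_tail) (auto simp: q_def)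
    moreover have "?B \<subseteq> {es. (1 + \<epsilon>) * M \<le> ?X es}"
    proof -
      have "(1 - \<epsilon>) * y \<le> (1 + \<epsilon>) * y" using assms by (intro mult_right_mono) auto
      then show ?thesis using low assms unfolding iff aM by auto
    qed
    then have "measure_pmf.prob ?S ?B \<le> measure_pmf.prob ?S {es. (1 + \<epsilon>) * M \<le> ?X es}"
      by (intro measure_pmf.finite_measure_mono) auto
    moreover have "L / 16 \<le> M * \<epsilon>\<^sup>2 / 4"
    proof -
      \<comment> \<open>The crude factor 4 already matches the exponent \<open>L / 16\<close> of the
        other case.\<close>
      have "(1 + \<epsilon>) * M \<le> 4 * M" using assms a by (intro mult_right_mono) (auto simp: M_def)
      then have "a * \<epsilon>\<^sup>2 \<le> 4 * M * \<epsilon>\<^sup>2" unfolding aM by (intro mult_right_mono) auto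
      then show ?thesis using L' by linarith
    qed
    then have "exp (- M * \<epsilon>\<^sup>2 / 4) \<le> exp (- L / 16)" by simp
    ultimately show ?thesis by linarith
  next
    case mid
    then have "?B = {}" by auto
    then show ?thesis by simp
  qed
qed

section \<open>From correct single estimates to the approximation guarantee\<close>

lemma bicriteria_approx_ccdh_estimate:
  fixes as :: "'v answer list"
  assumes "finite V" "0 < \<epsilon>D" "0 < \<epsilon>R" "\<epsilon>R < 1"
    and deg: "\<And>d. real d \<le> h' \<Longrightarrow> d \<in> {1..card V} \<Longrightarrow>
      (1 - \<epsilon>R) * real (ccdh V E (real d)) \<le>
        real (card V) / real s * real (length (filter (degree_at_least d) as)) \<and>
      real (card V) / real s * real (length (filter (degree_at_least d) as)) \<le>
        (1 + \<epsilon>R) * real (ccdh V E (real d))"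
    and edge: "\<And>d v. h' < real d \<Longrightarrow> d \<in> {1..card V} \<Longrightarrow> v \<in> V \<Longrightarrow>
      ((1 + \<epsilon>D) * real d \<le> real (vdeg E v) \<longrightarrow>
        real d \<le> real m / real r * real (length (filter (edge_at v) as))) \<and>
      (real d \<le> real m / real r * real (length (filter (edge_at v) as)) \<longrightarrow>
        (1 - \<epsilon>D) * real d \<le> real (vdeg E v))"
  shows "bicriteria_approx V E \<epsilon>D \<epsilon>R (ccdh_estimate V m s r h' as)"
  unfolding bicriteria_approx_def
proof
  fix d assume d: "d \<in> {1..card V}"
  let ?C = "\<lambda>y. real (ccdh V E y)" and ?A = "ccdh_estimate V m s r h' as d"
  show "(1 - \<epsilon>R) * ?C ((1 + \<epsilon>D) * real d) \<le> ?A \<and> ?A \<le> (1 + \<epsilon>R) * ?C ((1 - \<epsilon>D) * real d)"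
  proof (cases "real d \<le> h'")
    case True
    \<comment> \<open>For small \<open>d\<close> the estimate is close to \<open>C(d)\<close>
      itself; shifting the argument by the factors \<open>1 \<plusminus> \<epsilon>D\<close> only
      loosens the bounds.\<close>
    have "?C ((1 + \<epsilon>D) * real d) \<le> ?C (real d)" "?C (real d) \<le> ?C ((1 - \<epsilon>D) * real d)"
      using assms(1,2) by (auto intro!: ccdh_antimono simp: algebra_simps)
    then have "(1 - \<epsilon>R) * ?C ((1 + \<epsilon>D) * real d) \<le> (1 - \<epsilon>R) * ?C (real d)"
      "(1 + \<epsilon>R) * ?C (real d) \<le> (1 + \<epsilon>R) * ?C ((1 - \<epsilon>D) * real d)"
      using assms(3,4) by (auto intro!: mult_left_mono)
    then show ?thesis
      using deg[OF True d] True by (simp add: ccdh_estimate_def)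
  next
    case False
    let ?T = "{v \<in> V. real d \<le> real m / real r * real (length (filter (edge_at v) as))}"
    have A: "?A = real (card ?T)" using False by (simp add: ccdh_estimate_def)
    \<comment> \<open>An inclusion of sets on either side of \<open>?T\<close>; the factors
      \<open>1 \<plusminus> \<epsilon>R\<close> then only loosen the bounds.\<close>
    have "?C ((1 + \<epsilon>D) * real d) \<le> real (card ?T)" "real (card ?T) \<le> ?C ((1 - \<epsilon>D) * real d)"
      unfolding ccdh_def of_nat_le_iff using False edge d assms(1)
      by (intro card_mono; fastforce)+
    moreover have "(1 - \<epsilon>R) * ?C ((1 + \<epsilon>D) * real d) \<le> 1 * ?C ((1 + \<epsilon>D) * real d)"
      "1 * ?C ((1 - \<epsilon>D) * real d) \<le> (1 + \<epsilon>R) * ?C ((1 - \<epsilon>D) * real d)"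
      using assms by (intro mult_right_mono; simp)+
    ultimately show ?thesis unfolding A by linarith
  qed
qed

text \<open>A union bound over at most \<open>card V\<close> values of \<open>d \<le> h'\<close> for
  the vertex sample and at most \<open>(card V)\<^sup>2\<close> pairs of \<open>v\<close> and
  \<open>d > h'\<close> for the edge sample. In the first range
  \<open>C(d) \<ge> C(h') \<ge> h'\<close>, in the second the threshold exceeds \<open>h'\<close>,
  so \<open>h'\<close> is the worst case in both conditions on sample sizes.\<close>

lemma prob_sampling_plan:
  fixes \<epsilon>D \<epsilon>R h' L :: real
  assumes V: "finite V" "V \<noteq> {}" and E: "finite E" "E \<noteq> {}"
    and eps: "0 < \<epsilon>D" "\<epsilon>D < 1" "0 < \<epsilon>R" "\<epsilon>R < 1"
    and pos: "0 < s" "0 < r" "0 < h'" and h': "h' \<le> real (ccdh V E h')"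
    and s: "L \<le> real s * h' / real (card V) * \<epsilon>R\<^sup>2"
    and r: "L \<le> real r * h' / real (card E) * \<epsilon>D\<^sup>2"
  shows "1 - real (card V) * (2 * exp (- L / 4)) - (real (card V))\<^sup>2 * exp (- L / 16) \<le>
    measure_pmf.prob (run_plans E (sampling_plan V (card E) s r h'))
      {C'. bicriteria_approx V E \<epsilon>D \<epsilon>R C'}"
proof -
  let ?S = "replicate_pmf s (pmf_of_set V)" and ?R = "replicate_pmf r (pmf_of_set E)"
  let ?as = "\<lambda>vs es. map (\<lambda>v. Degree_Answer (vdeg E v)) vs @ map Edge_Answer es"
  let ?I = "{d \<in> {1..card V}. real d \<le> h'}" and ?J = "{d \<in> {1..card V}. h' < real d}"
  let ?Y = "\<lambda>d vs. real (card V) / real s * real (length (filter (\<lambda>v. d \<le> vdeg E v) vs))"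
  let ?Z = "\<lambda>v es. real (card E) / real r * real (length (filter (\<lambda>e. v \<in> e) es))"
  define A where "A d = {vs. \<not> ((1 - \<epsilon>R) * real (ccdh V E (real d)) \<le> ?Y d vs \<and>
      ?Y d vs \<le> (1 + \<epsilon>R) * real (ccdh V E (real d)))}" for d
  define B where "B v d = {es. \<not> (((1 + \<epsilon>D) * real d \<le> real (vdeg E v) \<longrightarrow> real d \<le> ?Z v es) \<and>
      (real d \<le> ?Z v es \<longrightarrow> (1 - \<epsilon>D) * real d \<le> real (vdeg E v)))}" for v d
  let ?UA = "\<Union>d\<in>?I. A d" and ?UB = "\<Union>x\<in>V \<times> ?J. B (fst x) (snd x)"
  let ?PP = "pair_pmf ?S ?R"
  let ?f = "\<lambda>(vs, es). ccdh_estimate V (card E) s r h' (?as vs es)"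
  let ?G = "{C'. bicriteria_approx V E \<epsilon>D \<epsilon>R C'}"
  have A_le: "measure_pmf.prob ?S (A d) \<le> 2 * exp (- L / 4)" if "d \<in> ?I" for d
  proof -
    have "h' \<le> real (ccdh V E (real d))"
      using h' ccdh_antimono[OF V(1), of "real d" h' E] that by simp
    then have "real s * h' / real (card V) * \<epsilon>R\<^sup>2 \<le>
        real s * real (ccdh V E (real d)) / real (card V) * \<epsilon>R\<^sup>2"
      by (intro mult_right_mono divide_right_mono mult_left_mono) auto
    then show ?thesis
      unfolding A_def using V eps pos s by (intro degree_sampling_failure) auto
  qed
  have B_le: "measure_pmf.prob ?R (B (fst x) (snd x)) \<le> exp (- L / 16)" if "x \<in> V \<times> ?J" for x
  proof -
    have "real r * h' / real (card E) * \<epsilon>D\<^sup>2 \<le> real r * real (snd x) / real (card E) * \<epsilon>D\<^sup>2"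
      using that by (intro mult_right_mono divide_right_mono mult_left_mono) auto
    then show ?thesis
      unfolding B_def using E eps pos r by (intro edge_sampling_failure) auto
  qed
  have "card ?I \<le> card {1..card V}" "card ?J \<le> card {1..card V}"
    by (intro card_mono; auto)+
  then have card: "card ?I \<le> card V" "card ?J \<le> card V" by simp_all
  have "measure_pmf.prob ?S ?UA \<le> (\<Sum>d\<in>?I. measure_pmf.prob ?S (A d))"
    by (intro measure_UNION_le) auto
  also have "\<dots> \<le> real (card ?I) * (2 * exp (- L / 4))"
    by (rule sum_bounded_above) (rule A_le)
  also have "\<dots> \<le> real (card V) * (2 * exp (- L / 4))"
    using card by (intro mult_right_mono) auto
  finally have UA: "measure_pmf.prob ?S ?UA \<le> real (card V) * (2 * exp (- L / 4))" .
  have "measure_pmf.prob ?R ?UB \<le> (\<Sum>x\<in>V \<times> ?J. measure_pmf.prob ?R (B (fst x) (snd x)))"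
    using V by (intro measure_UNION_le) auto
  also have "\<dots> \<le> real (card (V \<times> ?J)) * exp (- L / 16)"
    by (rule sum_bounded_above) (rule B_le)
  also have "\<dots> \<le> (real (card V))\<^sup>2 * exp (- L / 16)"
    using card by (intro mult_right_mono)
      (auto simp: card_cartesian_product power2_eq_square intro!: mult_left_mono)
  finally have UB: "measure_pmf.prob ?R ?UB \<le> (real (card V))\<^sup>2 * exp (- L / 16)" .
  have good: "?f (vs, es) \<in> ?G" if "vs \<notin> ?UA" "es \<notin> ?UB" for vs es
  proof -
    have "bicriteria_approx V E \<epsilon>D \<epsilon>R (ccdh_estimate V (card E) s r h' (?as vs es))"
    proof (rule bicriteria_approx_ccdh_estimate, goal_cases)
      case (5 d)
      then have "vs \<notin> A d" using that by auto
      then show ?case unfolding A_def degree_count by simp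
    next
      case (6 d v)
      then have "es \<notin> B v d" using that by force
      then show ?case unfolding B_def edge_count by simp
    qed (use V eps in auto)
    then show ?thesis by simp
  qed
  have "1 - measure_pmf.prob ?PP (?f -` ?G) = measure_pmf.prob ?PP (- (?f -` ?G))"
    by (simp add: measure_pmf.prob_compl[symmetric] Compl_eq_Diff_UNIV)
  also have "\<dots> \<le> measure_pmf.prob ?PP (fst -` ?UA \<union> snd -` ?UB)"
  proof (intro measure_pmf.finite_measure_mono subsetI)
    fix x assume "x \<in> - (?f -` ?G)"
    then show "x \<in> fst -` ?UA \<union> snd -` ?UB"
      using good[of "fst x" "snd x"] unfolding prod.collapse by blast
  qed simp
  also have "\<dots> \<le> measure_pmf.prob ?PP (fst -` ?UA) + measure_pmf.prob ?PP (snd -` ?UB)"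
    by (intro measure_Un_le) auto
  \<comment> \<open>Each failure event concerns one component of the pair, so its probability is
    that under the marginal.\<close>
  also have "\<dots> = measure_pmf.prob ?S ?UA + measure_pmf.prob ?R ?UB"
    by (simp only: measure_map_pmf[symmetric] map_fst_pair_pmf map_snd_pair_pmf)
  finally show ?thesis
    unfolding run_sampling_plan measure_map_pmf using UA UB by linarith
qed

section \<open>Consequences of having an h-index, and the choice of parameters\<close>

lemma h_index_edges:
  assumes "is_h_index V E h"
  shows "E \<noteq> {}"
proof
  assume "E = {}"
  then have "ccdh V E (real h) = 0"
    using assms by (simp add: is_h_index_def ccdh_def vdeg_def)
  then show False using assms by (auto simp: is_h_index_def)
qed

lemma simple_graph_finite_edges:
  assumes "simple_graph V E"
  shows "finite E"
  using assms finite_subset[of E "Pow V"] by (auto simp: simple_graph_def)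

text \<open>Keeps \<open>ln n\<close> away from 0, so that a multiple of it can absorb rounding in
  the query bound.\<close>

lemma simple_graph_card_ge_2:
  assumes "simple_graph V E" "E \<noteq> {}"
  shows "2 \<le> card V"
  using assms by (metis card_mono ex_in_conv simple_graph_def)

theorem theorem4p7:
  fixes c :: real
  assumes "c > 0"
  shows "\<exists>(alg :: nat \<Rightarrow> nat \<Rightarrow> real \<Rightarrow> real \<Rightarrow> real \<Rightarrow> nat plan pmf) (K :: real) (p :: nat).
    \<forall>(n :: nat) (m :: nat) (h :: nat) (E :: nat set set) (\<epsilon>D :: real) (\<epsilon>R :: real) (h' :: real).
      simple_graph {..<n} E \<and> card E = m \<and> is_h_index {..<n} E h \<and>
      0 < \<epsilon>D \<and> \<epsilon>D < 1 \<and> 0 < \<epsilon>R \<and> \<epsilon>R < 1 \<and>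
      real h / 2 \<le> h' \<and> h' \<le> real h \<longrightarrow>
      (\<forall>(qs, out) \<in> set_pmf (alg n m \<epsilon>D \<epsilon>R h').
         valid_queries {..<n} qs \<and>
         real (length qs) \<le>
           K * ln (real n) ^ p *
             (real n / (real h * \<epsilon>R\<^sup>2) + real m / (real h * \<epsilon>D\<^sup>2))) \<and>
      measure_pmf.prob (run_plans E (alg n m \<epsilon>D \<epsilon>R h'))
          {C'. bicriteria_approx {..<n} E \<epsilon>D \<epsilon>R C'}
        \<ge> 1 - 1 / real n powr c"
proof -
  \<comment> \<open>The 16 cancels the one in \<open>exp (- L / 16)\<close>, leaving
    \<open>n powr - (c + 3)\<close>. Of the 3 spare powers of \<open>n\<close>, two pay for the
    pairs in the union bound and one for a constant factor 2.\<close>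
  define \<kappa> where "\<kappa> = 16 * (c + 3)"
  \<comment> \<open>The sample size that solves
    \<open>\<kappa> * ln n \<le> k * h' / N * \<epsilon>\<^sup>2\<close>, used with
    \<open>N = n\<close> for vertices and \<open>N = m\<close> for edges. In its upper bound the
    factor 2 comes from \<open>h' \<ge> h / 2\<close> and the 1 from rounding up.\<close>
  define k where "k N n h' \<epsilon> = nat \<lceil>\<kappa> * ln (real n) * real N / (h' * \<epsilon>\<^sup>2)\<rceil>"
    for N n :: nat and h' \<epsilon> :: real
  have \<kappa>: "0 < \<kappa>" using assms by (simp add: \<kappa>_def)
  have k_pos: "0 < k N n h' \<epsilon>"
    and k_ge: "\<kappa> * ln (real n) \<le> real (k N n h' \<epsilon>) * h' / real N * \<epsilon>\<^sup>2"
    and k_le: "real (k N n h' \<epsilon>) \<le> 2 * \<kappa> * ln (real n) * (real N / (real h * \<epsilon>\<^sup>2)) + 1"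
    if "0 < N" "2 \<le> n" "0 < h" "real h / 2 \<le> h'" "0 < \<epsilon>" for N n h :: nat and h' \<epsilon> :: real
  proof -
    let ?x = "\<kappa> * ln (real n) * real N / (h' * \<epsilon>\<^sup>2)"
    have h': "0 < h'" using that by linarith
    have num: "0 < \<kappa> * ln (real n) * real N" using \<kappa> that by simp
    then have x: "0 < ?x" using h' that by simp
    then show "0 < k N n h' \<epsilon>" by (simp add: k_def)
    have "?x \<le> real (k N n h' \<epsilon>)" unfolding k_def by linarith
    then show "\<kappa> * ln (real n) \<le> real (k N n h' \<epsilon>) * h' / real N * \<epsilon>\<^sup>2"
      using h' that by (simp add: field_simps)
    have "?x \<le> \<kappa> * ln (real n) * real N / (real h / 2 * \<epsilon>\<^sup>2)"
      using h' num that by (intro divide_left_mono mult_right_mono) auto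
    also have "\<dots> = 2 * \<kappa> * ln (real n) * (real N / (real h * \<epsilon>\<^sup>2))"
      by simp
    finally show "real (k N n h' \<epsilon>) \<le> 2 * \<kappa> * ln (real n) * (real N / (real h * \<epsilon>\<^sup>2)) + 1"
      using x unfolding k_def by linarith
  qed
  \<comment> \<open>Only the given inputs occur here; \<open>h\<close> and \<open>E\<close> enter in
    the analysis alone.\<close>
  define alg where "alg n m \<epsilon>D \<epsilon>R h' =
      sampling_plan {..<n} m (k n n h' \<epsilon>R) (k m n h' \<epsilon>D) h'" for n m \<epsilon>D \<epsilon>R h'
  show ?thesis
  proof (rule exI[of _ alg], rule exI[of _ "2 * \<kappa> + 4"], rule exI[of _ 1], intro allI impI,
      elim conjE)
    fix n m h :: nat and E :: "nat set set" and \<epsilon>D \<epsilon>R h' :: real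
    assume G: "simple_graph {..<n} E" and m: "card E = m" and h: "is_h_index {..<n} E h"
      and eps: "0 < \<epsilon>D" "\<epsilon>D < 1" "0 < \<epsilon>R" "\<epsilon>R < 1"
      and h': "real h / 2 \<le> h'" "h' \<le> real h"
    let ?s = "k n n h' \<epsilon>R" and ?r = "k m n h' \<epsilon>D"
    let ?Q = "real n / (real h * \<epsilon>R\<^sup>2) + real m / (real h * \<epsilon>D\<^sup>2)"
    let ?L = "\<kappa> * ln (real n)"
    have E: "E \<noteq> {}" "finite E"
      using h_index_edges[OF h] simple_graph_finite_edges[OF G] by auto
    have n: "2 \<le> n" using simple_graph_card_ge_2[OF G E(1)] by simp
    have m_pos: "0 < m" using E m by (auto simp: card_gt_0_iff)
    have hn: "1 \<le> h" "h \<le> n" and hC: "h \<le> ccdh {..<n} E (real h)"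
      using h by (auto simp: is_h_index_def)
    have h'_pos: "0 < h'" using hn h' by simp
    have V: "{..<n} \<noteq> {}" using n by (simp add: lessThan_empty_iff)
    have "ln 2 \<le> ln (real n)" using n by simp
    then have ln: "1 / 2 \<le> ln (real n)" using ln2_ge_two_thirds by simp
    have len: "real (?s + ?r) \<le> (2 * \<kappa> + 4) * ln (real n) ^ 1 * ?Q"
    proof -
      \<comment> \<open>As \<open>h \<le> n\<close>, this gives \<open>?Q \<ge> 1\<close> and so
        \<open>ln n * ?Q \<ge> 1 / 2\<close>. The two roundings add at most 2, which the 4 in
        \<open>2 * \<kappa> + 4\<close> absorbs.\<close>
      have "\<epsilon>R\<^sup>2 \<le> 1" using eps by (simp add: power_le_one)
      then have "real h * \<epsilon>R\<^sup>2 \<le> real n * 1" using hn by (intro mult_mono) auto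
      then have "1 \<le> real n / (real h * \<epsilon>R\<^sup>2)" using hn eps by simp
      also have "\<dots> \<le> ?Q" by simp
      finally have "1 / 2 * 1 \<le> ln (real n) * ?Q"
        using ln by (intro mult_mono) auto
      moreover have "real ?s \<le> 2 * \<kappa> * ln (real n) * (real n / (real h * \<epsilon>R\<^sup>2)) + 1"
        "real ?r \<le> 2 * \<kappa> * ln (real n) * (real m / (real h * \<epsilon>D\<^sup>2)) + 1"
        using n m_pos hn h' eps by (intro k_le; simp)+
      moreover have "(2 * \<kappa> + 4) * ln (real n) ^ 1 * ?Q =
          2 * \<kappa> * ln (real n) * (real n / (real h * \<epsilon>R\<^sup>2)) +
          2 * \<kappa> * ln (real n) * (real m / (real h * \<epsilon>D\<^sup>2)) + 4 * (ln (real n) * ?Q)"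
        by (simp only: power_one_right distrib_left distrib_right mult.assoc)
      ultimately show ?thesis by simp
    qed
    have "1 - 1 / real n powr c \<le>
        1 - real (card {..<n}) * (2 * exp (- ?L / 4)) - (real (card {..<n}))\<^sup>2 * exp (- ?L / 16)"
    proof -
      let ?e = "real n powr - (c + 3)"
      have e: "exp (- ?L / 16) = ?e"
        using n by (simp add: powr_def \<kappa>_def field_simps)
      have "exp (- ?L / 4) \<le> exp (- ?L / 16)"
        using ln \<kappa> by simp
      \<comment> \<open>The factor 2 is at most \<open>n\<close>, so the vertex failures cost no
        more than the edge failures.\<close>
      then have "real n * (2 * exp (- ?L / 4)) \<le> real n * (real n * ?e)"
        using n unfolding e by (intro mult_left_mono mult_mono) auto
      then have "real n * (2 * exp (- ?L / 4)) + (real n)\<^sup>2 * exp (- ?L / 16) \<le>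
          2 * (real n)\<^sup>2 * ?e"
        unfolding e by (simp add: power2_eq_square)
      also have "\<dots> \<le> real n ^ 3 * ?e"
        using n by (intro mult_right_mono) (auto simp: power3_eq_cube power2_eq_square)
      also have "\<dots> = real n powr 3 * ?e"
        using n by (simp add: powr_numeral)
      also have "\<dots> = 1 / real n powr c"
        unfolding powr_add[symmetric] by (simp add: powr_minus_divide)
      finally show ?thesis by simp
    qed
    also have "\<dots> \<le> measure_pmf.prob (run_plans E (alg n m \<epsilon>D \<epsilon>R h'))
        {C'. bicriteria_approx {..<n} E \<epsilon>D \<epsilon>R C'}"
      unfolding alg_def m[symmetric]
    proof (rule prob_sampling_plan)
      \<comment> \<open>The chain \<open>h' \<le> h \<le> C(h) \<le> C(h')\<close>.\<close>
      show "h' \<le> real (ccdh {..<n} E h')"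
        using hC h' ccdh_antimono[of "{..<n}" h' "real h" E] by simp
      show "?L \<le> real (k n n h' \<epsilon>R) * h' / real (card {..<n}) * \<epsilon>R\<^sup>2"
        using k_ge[of n n h h' \<epsilon>R] n hn h' eps by simp
      show "?L \<le> real (k (card E) n h' \<epsilon>D) * h' / real (card E) * \<epsilon>D\<^sup>2"
        using k_ge[of m n h h' \<epsilon>D] n m m_pos hn h' eps by simp
      show "0 < k n n h' \<epsilon>R" "0 < k (card E) n h' \<epsilon>D"
        using k_pos[of n n h h' \<epsilon>R] k_pos[of m n h h' \<epsilon>D] n m m_pos hn h' eps by simp_all
    qed (use V E eps h'_pos in auto)
    finally have "1 - 1 / real n powr c \<le> measure_pmf.prob (run_plans E (alg n m \<epsilon>D \<epsilon>R h'))
        {C'. bicriteria_approx {..<n} E \<epsilon>D \<epsilon>R C'}" .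
    moreover have "valid_queries {..<n} qs \<and>
        real (length qs) \<le> (2 * \<kappa> + 4) * ln (real n) ^ 1 * ?Q"
      if "(qs, out) \<in> set_pmf (alg n m \<epsilon>D \<epsilon>R h')" for qs out
      using sampling_plan_queries[OF _ V that[unfolded alg_def]] len by simp
    ultimately show "(\<forall>(qs, out) \<in> set_pmf (alg n m \<epsilon>D \<epsilon>R h').
         valid_queries {..<n} qs \<and>
         real (length qs) \<le> (2 * \<kappa> + 4) * ln (real n) ^ 1 * ?Q) \<and>
      1 - 1 / real n powr c \<le> measure_pmf.prob (run_plans E (alg n m \<epsilon>D \<epsilon>R h'))
        {C'. bicriteria_approx {..<n} E \<epsilon>D \<epsilon>R C'}"
      by blast
  qed
qed

end
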